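(* Let $R$ be a ring. Then the following statements are equivalent. (i) $R$ is a von Neumann regular ring. (ii) Every ideal of $R$ is a pure ideal. (iii) Every principal ideal of $R$ is a pure ideal. (iv) Every maximal ideal of $R$ is a pure ideal. (v) $\mathrm{Ker}\,\pi_{\mathfrak{m}}=\mathfrak{m}$ for all maximal ideals $\mathfrak{m}$ of $R$. (vi) $R_{\mathfrak{p}}$ is a semiprimitive ring for all prime ideals $\mathfrak{p}$ of $R$. (vii) $R_{\mathfrak{m}}$ is a semiprimitive ring for all maximal ideals $\mathfrak{m}$ of $R$.
   Context: All rings are commutative with identity. An ideal $I$ of $R$ is called pure if for each $a\in I$ there exists $b\in I$ such that $a(1-b)=0$. For a prime ideal $\mathfrak{p}$, $\pi_{\mathfrak{p}}:R\to R_{\mathfrak{p}}$ is the canonical localization map, so $\mathrm{Ker}\,\pi_{\mathfrak{p}}=\{a\in R:\exists s\in R\setminus\mathfrak{p},\ sa=0\}$. A ring is semiprimitive if its Jacobson radical is zero. *)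

theory Defs
  imports "HOL-Algebra.RingHom"
begin

section \<open>Von Neumann regular rings, pure ideals, semiprimitive rings\<close>

text \<open>All rings are commutative with identity, i.e. \<^locale>\<open>cring\<close>; the zero ring is
  included.\<close>

locale von_neumann_regular = cring R for R (structure) +
  assumes regular: "a \<in> carrier R \<Longrightarrow> \<exists>b \<in> carrier R. a = a \<otimes> b \<otimes> a"

locale pure_ideal = ideal I R for I and R (structure) +
  assumes pure: "a \<in> I \<Longrightarrow> \<exists>b \<in> I. a \<otimes> (\<one> \<ominus> b) = \<zero>"

text \<open>The intersection with the carrier gives the empty intersection its conventional value: the
  Jacobson radical of the zero ring is the whole ring.\<close>

definition jacobson_radical :: "('a, 'b) ring_scheme \<Rightarrow> 'a set"
  where "jacobson_radical R = carrier R \<inter> \<Inter> {M. maximalideal M R}"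

locale semiprimitive_ring = cring R for R (structure) +
  assumes jacobson_radical_zero: "jacobson_radical R = {\<zero>}"


section \<open>Localization\<close>

definition loc_rel :: "('a, 'b) ring_scheme \<Rightarrow> 'a set \<Rightarrow> (('a \<times> 'a) \<times> ('a \<times> 'a)) set"
  where "loc_rel R S =
    {((a, s), (b, t)). a \<in> carrier R \<and> s \<in> S \<and> b \<in> carrier R \<and> t \<in> S \<and>
       (\<exists>u \<in> S. u \<otimes>\<^bsub>R\<^esub> (t \<otimes>\<^bsub>R\<^esub> a) = u \<otimes>\<^bsub>R\<^esub> (s \<otimes>\<^bsub>R\<^esub> b))}"

text \<open>The fraction \<open>a / s\<close>, as an equivalence class of pairs.\<close>

definition loc_frac :: "('a, 'b) ring_scheme \<Rightarrow> 'a set \<Rightarrow> 'a \<Rightarrow> 'a \<Rightarrow> ('a \<times> 'a) set"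
  where "loc_frac R S a s = loc_rel R S `` {(a, s)}"

text \<open>The operations are defined on all representatives at once; \<open>loc_mult_frac\<close> and
  \<open>loc_add_frac\<close> below show that they are the usual operations on fractions.\<close>

definition localization :: "('a, 'b) ring_scheme \<Rightarrow> 'a set \<Rightarrow> ('a \<times> 'a) set ring"
  where "localization R S =
    \<lparr> carrier = (carrier R \<times> S) // loc_rel R S,
      mult = (\<lambda>X Y. \<Union>x \<in> X. \<Union>y \<in> Y.
                loc_frac R S (fst x \<otimes>\<^bsub>R\<^esub> fst y) (snd x \<otimes>\<^bsub>R\<^esub> snd y)),
      one = loc_frac R S \<one>\<^bsub>R\<^esub> \<one>\<^bsub>R\<^esub>,
      zero = loc_frac R S \<zero>\<^bsub>R\<^esub> \<one>\<^bsub>R\<^esub>,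
      add = (\<lambda>X Y. \<Union>x \<in> X. \<Union>y \<in> Y.
               loc_frac R S ((snd y \<otimes>\<^bsub>R\<^esub> fst x) \<oplus>\<^bsub>R\<^esub> (snd x \<otimes>\<^bsub>R\<^esub> fst y))
                 (snd x \<otimes>\<^bsub>R\<^esub> snd y)) \<rparr>"

definition localization_at :: "('a, 'b) ring_scheme \<Rightarrow> 'a set \<Rightarrow> ('a \<times> 'a) set ring"
  where "localization_at R P = localization R (carrier R - P)"

definition loc_map :: "('a, 'b) ring_scheme \<Rightarrow> 'a set \<Rightarrow> 'a \<Rightarrow> ('a \<times> 'a) set"
  where "loc_map R P a = loc_frac R (carrier R - P) a \<one>\<^bsub>R\<^esub>"


section \<open>The localization is a commutative ring\<close>

locale mult_submonoid = cring R + submonoid S R for R (structure) and S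
begin

lemma S_carr [simp]: "s \<in> S \<Longrightarrow> s \<in> carrier R"
  by (rule mem_carrier)

lemma equiv_loc_rel: "equiv (carrier R \<times> S) (loc_rel R S)"
proof (rule equivI)
  show "loc_rel R S \<subseteq> (carrier R \<times> S) \<times> (carrier R \<times> S)"
    by (auto simp: loc_rel_def)
  show "refl_on (carrier R \<times> S) (loc_rel R S)"
    by (auto simp: loc_rel_def refl_on_def)
  show "sym (loc_rel R S)"
    by (auto simp: loc_rel_def sym_def) metis
  show "trans (loc_rel R S)"
  proof (rule transI, clarify)
    fix a s b t c r
    assume "((a, s), (b, t)) \<in> loc_rel R S" "((b, t), (c, r)) \<in> loc_rel R S"
    then obtain u v where c: "a \<in> carrier R" "s \<in> S" "b \<in> carrier R" "t \<in> S" "c \<in> carrier R" "r \<in> S"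
      "u \<in> S" "v \<in> S" and
      1: "u \<otimes> (t \<otimes> a) = u \<otimes> (s \<otimes> b)" and 2: "v \<otimes> (r \<otimes> b) = v \<otimes> (t \<otimes> c)"
      by (auto simp: loc_rel_def)
    have "(u \<otimes> v \<otimes> t) \<otimes> (r \<otimes> a) = (v \<otimes> r) \<otimes> (u \<otimes> (t \<otimes> a))"
      using c by (simp add: m_ac)
    also have "\<dots> = (u \<otimes> s) \<otimes> (v \<otimes> (r \<otimes> b))"
      using c by (simp only: 1) (simp add: m_ac)
    also have "\<dots> = (u \<otimes> v \<otimes> t) \<otimes> (s \<otimes> c)"
      using c by (simp only: 2) (simp add: m_ac)
    finally show "((a, s), (c, r)) \<in> loc_rel R S"
      using c by (simp add: loc_rel_def) (rule bexI[of _ "u \<otimes> v \<otimes> t"], simp_all)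
  qed
qed

lemma loc_frac_eq_iff:
  assumes "a \<in> carrier R" "s \<in> S" "b \<in> carrier R" "t \<in> S"
  shows "loc_frac R S a s = loc_frac R S b t \<longleftrightarrow> (\<exists>u \<in> S. u \<otimes> (t \<otimes> a) = u \<otimes> (s \<otimes> b))"
  using eq_equiv_class_iff[OF equiv_loc_rel, of "(a, s)" "(b, t)"] assms
  by (auto simp: loc_frac_def loc_rel_def)

lemma loc_frac_eqI':
  assumes "u \<in> S" "a \<in> carrier R" "s \<in> S" "b \<in> carrier R" "t \<in> S" "u \<otimes> (t \<otimes> a) = u \<otimes> (s \<otimes> b)"
  shows "loc_frac R S a s = loc_frac R S b t"
  using assms loc_frac_eq_iff by blast

lemma loc_frac_eqI:
  assumes "a \<in> carrier R" "s \<in> S" "b \<in> carrier R" "t \<in> S" "t \<otimes> a = s \<otimes> b"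
  shows "loc_frac R S a s = loc_frac R S b t"
  by (rule loc_frac_eqI'[of \<one>]) (simp_all add: assms)

lemma loc_frac_mem:
  assumes "a \<in> carrier R" "s \<in> S"
  shows "(b, t) \<in> loc_frac R S a s \<longleftrightarrow>
    b \<in> carrier R \<and> t \<in> S \<and> (\<exists>u \<in> S. u \<otimes> (t \<otimes> a) = u \<otimes> (s \<otimes> b))"
  using assms by (auto simp: loc_frac_def loc_rel_def)

lemma loc_carrier_iff:
  "X \<in> carrier (localization R S) \<longleftrightarrow> (\<exists>a \<in> carrier R. \<exists>s \<in> S. X = loc_frac R S a s)"
  by (auto simp: localization_def quotient_def loc_frac_def)

lemma loc_fracE:
  assumes "X \<in> carrier (localization R S)"
  obtains a s where "a \<in> carrier R" "s \<in> S" "X = loc_frac R S a s"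
  using assms by (auto simp: loc_carrier_iff)

lemma loc_frac_carrier [intro, simp]:
  "a \<in> carrier R \<Longrightarrow> s \<in> S \<Longrightarrow> loc_frac R S a s \<in> carrier (localization R S)"
  by (auto simp: loc_carrier_iff)

lemma UN_loc_frac:
  assumes "a \<in> carrier R" "s \<in> S" "b \<in> carrier R" "t \<in> S"
    and "\<And>a' s' b' t'. (a', s') \<in> loc_frac R S a s \<Longrightarrow> (b', t') \<in> loc_frac R S b t \<Longrightarrow>
           f a' s' b' t' = f a s b t"
  shows "(\<Union>x \<in> loc_frac R S a s. \<Union>y \<in> loc_frac R S b t. f (fst x) (snd x) (fst y) (snd y)) = f a s b t"
proof -
  have "(a, s) \<in> loc_frac R S a s" "(b, t) \<in> loc_frac R S b t"
    using assms(1-4) by (auto simp: loc_frac_mem)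
  then have ne: "loc_frac R S a s \<noteq> {}" "loc_frac R S b t \<noteq> {}"
    by blast+
  have "(\<Union>x \<in> loc_frac R S a s. \<Union>y \<in> loc_frac R S b t. f (fst x) (snd x) (fst y) (snd y)) =
      (\<Union>x \<in> loc_frac R S a s. \<Union>y \<in> loc_frac R S b t. f a s b t)"
    by (intro SUP_cong refl assms(5)) simp_all
  also have "\<dots> = f a s b t"
    using ne by simp
  finally show ?thesis .
qed

lemma loc_mult_frac:
  assumes c: "a \<in> carrier R" "s \<in> S" "b \<in> carrier R" "t \<in> S"
  shows "loc_frac R S a s \<otimes>\<^bsub>localization R S\<^esub> loc_frac R S b t = loc_frac R S (a \<otimes> b) (s \<otimes> t)"
  unfolding localization_def monoid.simps
proof (rule UN_loc_frac[OF c, where f = "\<lambda>a s b t. loc_frac R S (a \<otimes> b) (s \<otimes> t)"])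
  fix a' s' b' t'
  assume "(a', s') \<in> loc_frac R S a s" "(b', t') \<in> loc_frac R S b t"
  then obtain u v where d: "a' \<in> carrier R" "s' \<in> S" "b' \<in> carrier R" "t' \<in> S" "u \<in> S" "v \<in> S"
    and 1: "u \<otimes> (s' \<otimes> a) = u \<otimes> (s \<otimes> a')" and 2: "v \<otimes> (t' \<otimes> b) = v \<otimes> (t \<otimes> b')"
    using c by (auto simp: loc_frac_mem)
  have "(u \<otimes> v) \<otimes> ((s \<otimes> t) \<otimes> (a' \<otimes> b')) = (u \<otimes> (s \<otimes> a')) \<otimes> (v \<otimes> (t \<otimes> b'))"
    using c d by (simp add: m_ac)
  also have "\<dots> = (u \<otimes> (s' \<otimes> a)) \<otimes> (v \<otimes> (t' \<otimes> b))" by (simp add: 1 2)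
  also have "\<dots> = (u \<otimes> v) \<otimes> ((s' \<otimes> t') \<otimes> (a \<otimes> b))"
    using c d by (simp add: m_ac)
  finally show "loc_frac R S (a' \<otimes> b') (s' \<otimes> t') = loc_frac R S (a \<otimes> b) (s \<otimes> t)"
    using c d by (intro loc_frac_eqI'[of "u \<otimes> v"]) simp_all
qed

lemma loc_add_frac:
  assumes c: "a \<in> carrier R" "s \<in> S" "b \<in> carrier R" "t \<in> S"
  shows "loc_frac R S a s \<oplus>\<^bsub>localization R S\<^esub> loc_frac R S b t =
    loc_frac R S ((t \<otimes> a) \<oplus> (s \<otimes> b)) (s \<otimes> t)"
  unfolding localization_def ring.simps monoid.simps
proof (rule UN_loc_frac[OF c, where f = "\<lambda>a s b t. loc_frac R S ((t \<otimes> a) \<oplus> (s \<otimes> b)) (s \<otimes> t)"])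
  fix a' s' b' t'
  assume "(a', s') \<in> loc_frac R S a s" "(b', t') \<in> loc_frac R S b t"
  then obtain u v where d: "a' \<in> carrier R" "s' \<in> S" "b' \<in> carrier R" "t' \<in> S" "u \<in> S" "v \<in> S"
    and 1: "u \<otimes> (s' \<otimes> a) = u \<otimes> (s \<otimes> a')" and 2: "v \<otimes> (t' \<otimes> b) = v \<otimes> (t \<otimes> b')"
    using c by (auto simp: loc_frac_mem)
  have "(u \<otimes> v) \<otimes> ((s \<otimes> t) \<otimes> ((t' \<otimes> a') \<oplus> (s' \<otimes> b'))) =
      (v \<otimes> t \<otimes> t') \<otimes> (u \<otimes> (s \<otimes> a')) \<oplus> (u \<otimes> s \<otimes> s') \<otimes> (v \<otimes> (t \<otimes> b'))"
    using c d by (simp add: m_ac r_distr)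
  also have "\<dots> = (v \<otimes> t \<otimes> t') \<otimes> (u \<otimes> (s' \<otimes> a)) \<oplus> (u \<otimes> s \<otimes> s') \<otimes> (v \<otimes> (t' \<otimes> b))"
    by (simp add: 1 2)
  also have "\<dots> = (u \<otimes> v) \<otimes> ((s' \<otimes> t') \<otimes> ((t \<otimes> a) \<oplus> (s \<otimes> b)))"
    using c d by (simp add: m_ac r_distr)
  finally show "loc_frac R S ((t' \<otimes> a') \<oplus> (s' \<otimes> b')) (s' \<otimes> t') =
      loc_frac R S ((t \<otimes> a) \<oplus> (s \<otimes> b)) (s \<otimes> t)"
    using c d by (intro loc_frac_eqI'[of "u \<otimes> v"]) simp_all
qed

lemma loc_one: "\<one>\<^bsub>localization R S\<^esub> = loc_frac R S \<one> \<one>"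
  and loc_zero: "\<zero>\<^bsub>localization R S\<^esub> = loc_frac R S \<zero> \<one>"
  by (simp_all add: localization_def)

lemmas loc_ops = loc_mult_frac loc_add_frac loc_one loc_zero

lemma cring_localization: "cring (localization R S)" (is "cring ?L")
proof (rule cringI)
  show "abelian_group ?L"
  proof (rule abelian_groupI)
    fix X Y assume "X \<in> carrier ?L" "Y \<in> carrier ?L"
    then show "X \<oplus>\<^bsub>?L\<^esub> Y \<in> carrier ?L"
      by (elim loc_fracE) (simp add: loc_add_frac)
  next
    show "\<zero>\<^bsub>?L\<^esub> \<in> carrier ?L"
      by (simp add: loc_zero)
  next
    fix X Y Z assume "X \<in> carrier ?L" "Y \<in> carrier ?L" "Z \<in> carrier ?L"
    then show "X \<oplus>\<^bsub>?L\<^esub> Y \<oplus>\<^bsub>?L\<^esub> Z = X \<oplus>\<^bsub>?L\<^esub> (Y \<oplus>\<^bsub>?L\<^esub> Z)"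
      by (elim loc_fracE) (simp add: loc_add_frac r_distr m_ac a_ac)
  next
    fix X Y assume "X \<in> carrier ?L" "Y \<in> carrier ?L"
    then show "X \<oplus>\<^bsub>?L\<^esub> Y = Y \<oplus>\<^bsub>?L\<^esub> X"
      by (elim loc_fracE) (simp add: loc_add_frac m_ac a_ac)
  next
    fix X assume "X \<in> carrier ?L"
    then show "\<zero>\<^bsub>?L\<^esub> \<oplus>\<^bsub>?L\<^esub> X = X"
      by (elim loc_fracE) (simp add: loc_zero loc_add_frac)
  next
    fix X assume "X \<in> carrier ?L"
    then obtain a s where X: "a \<in> carrier R" "s \<in> S" "X = loc_frac R S a s" by (rule loc_fracE)
    have "loc_frac R S (\<ominus> a) s \<oplus>\<^bsub>?L\<^esub> X = loc_frac R S \<zero> (s \<otimes> s)"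
      using X by (simp add: loc_add_frac r_minus l_neg)
    also have "\<dots> = \<zero>\<^bsub>?L\<^esub>"
      unfolding loc_zero using X by (intro loc_frac_eqI) simp_all
    finally show "\<exists>Y \<in> carrier ?L. Y \<oplus>\<^bsub>?L\<^esub> X = \<zero>\<^bsub>?L\<^esub>"
      using X by blast
  qed
  show "Group.comm_monoid ?L"
  proof (rule comm_monoidI)
    fix X Y assume "X \<in> carrier ?L" "Y \<in> carrier ?L"
    then show "X \<otimes>\<^bsub>?L\<^esub> Y \<in> carrier ?L"
      by (elim loc_fracE) (simp add: loc_mult_frac)
  next
    show "\<one>\<^bsub>?L\<^esub> \<in> carrier ?L"
      by (simp add: loc_one)
  next
    fix X Y Z assume "X \<in> carrier ?L" "Y \<in> carrier ?L" "Z \<in> carrier ?L"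
    then show "X \<otimes>\<^bsub>?L\<^esub> Y \<otimes>\<^bsub>?L\<^esub> Z = X \<otimes>\<^bsub>?L\<^esub> (Y \<otimes>\<^bsub>?L\<^esub> Z)"
      by (elim loc_fracE) (simp add: loc_mult_frac m_ac)
  next
    fix X assume "X \<in> carrier ?L"
    then show "\<one>\<^bsub>?L\<^esub> \<otimes>\<^bsub>?L\<^esub> X = X"
      by (elim loc_fracE) (simp add: loc_one loc_mult_frac)
  next
    fix X Y assume "X \<in> carrier ?L" "Y \<in> carrier ?L"
    then show "X \<otimes>\<^bsub>?L\<^esub> Y = Y \<otimes>\<^bsub>?L\<^esub> X"
      by (elim loc_fracE) (simp add: loc_mult_frac m_ac)
  qed
next
  fix X Y Z assume "X \<in> carrier ?L" "Y \<in> carrier ?L" "Z \<in> carrier ?L"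
  then obtain a s b t c r where c: "a \<in> carrier R" "s \<in> S" "b \<in> carrier R" "t \<in> S"
    "c \<in> carrier R" "r \<in> S"
    and XYZ: "X = loc_frac R S a s" "Y = loc_frac R S b t" "Z = loc_frac R S c r"
    by (elim loc_fracE)
  have "loc_frac R S ((t \<otimes> a \<oplus> s \<otimes> b) \<otimes> c) (s \<otimes> t \<otimes> r) =
    loc_frac R S (t \<otimes> r \<otimes> (a \<otimes> c) \<oplus> s \<otimes> r \<otimes> (b \<otimes> c)) (s \<otimes> r \<otimes> (t \<otimes> r))"
    using c by (intro loc_frac_eqI) (simp_all add: l_distr r_distr m_ac)
  then show "(X \<oplus>\<^bsub>?L\<^esub> Y) \<otimes>\<^bsub>?L\<^esub> Z = X \<otimes>\<^bsub>?L\<^esub> Z \<oplus>\<^bsub>?L\<^esub> Y \<otimes>\<^bsub>?L\<^esub> Z"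
    using c by (simp add: XYZ loc_mult_frac loc_add_frac)
qed

end

lemma (in primeideal) mult_submonoid_compl: "mult_submonoid R (carrier R - I)"
proof -
  have "\<one> \<notin> I"
    using I_notcarr one_imp_carrier by metis
  then have "submonoid (carrier R - I) R"
    by (intro submonoid.intro) (auto dest: I_prime)
  then show ?thesis
    by (intro mult_submonoid.intro is_cring)
qed

lemma (in primeideal) cring_localization_at: "cring (localization_at R I)"
  unfolding localization_at_def
  by (rule mult_submonoid.cring_localization[OF mult_submonoid_compl])

lemma (in primeideal) loc_map_hom: "loc_map R I \<in> ring_hom R (localization_at R I)"
proof -
  note M = mult_submonoid_compl
  have one: "\<one> \<in> carrier R - I"
    by (rule submonoid.one_closed[OF mult_submonoid.axioms(2)[OF M]])
  show ?thesis
    unfolding loc_map_def localization_at_def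
    by (rule ring_hom_memI)
      (simp_all only: mult_submonoid.loc_mult_frac[OF M] mult_submonoid.loc_add_frac[OF M]
        mult_submonoid.loc_one[OF M] mult_submonoid.loc_frac_carrier[OF M] one one_closed
        l_one r_one)
qed

lemma (in primeideal) kernel_loc_map:
  "a_kernel R (localization_at R I) (loc_map R I) = {a \<in> carrier R. \<exists>s \<in> carrier R - I. s \<otimes> a = \<zero>}"
proof -
  note M = mult_submonoid_compl
  have one: "\<one> \<in> carrier R - I"
    by (rule submonoid.one_closed[OF mult_submonoid.axioms(2)[OF M]])
  have "loc_frac R (carrier R - I) a \<one> = loc_frac R (carrier R - I) \<zero> \<one> \<longleftrightarrow>
      (\<exists>s \<in> carrier R - I. s \<otimes> a = \<zero>)" if "a \<in> carrier R" for a
    using mult_submonoid.loc_frac_eq_iff[OF M that one zero_closed one] that by simp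
  then show ?thesis
    unfolding a_kernel_def' loc_map_def localization_at_def mult_submonoid.loc_zero[OF M]
    by blast
qed

end

theory Submission
  imports Defs "HOL-Algebra.Ring_Divisibility"
begin

text \<open>Purity of a maximal ideal \<open>M\<close> says that every \<open>a \<in> M\<close> is killed by some \<open>1 - b \<notin> M\<close>, i.e. that
  \<open>a\<close> vanishes in the local ring at \<open>M\<close>. Since the Jacobson radical of that local ring consists of
  the fractions with numerator in \<open>M\<close>, semiprimitivity says the same. If this holds at all maximal
  ideals, then for each \<open>a\<close> no maximal ideal contains both \<open>a\<close> and its annihilator; hence
  \<open>1 = s + r a\<close> with \<open>s a = 0\<close>, and multiplying by \<open>a\<close> gives von Neumann regularity. Conversely, over
  a von Neumann regular ring every localization at a prime is a field.\<close>

section \<open>Maximal ideals, comaximality and annihilators\<close>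

text \<open>Zorn's lemma on the ideals above \<open>J\<close>. Properness is written as
  \<open>\<one> \<notin> I\<close>, a condition that visibly passes to unions of chains.\<close>

lemma (in cring) exists_maximalideal:
  assumes J: "ideal J R" and ne: "J \<noteq> carrier R"
  shows "\<exists>M. maximalideal M R \<and> J \<subseteq> M"
proof -
  let ?A = "{I. ideal I R \<and> J \<subseteq> I \<and> \<one> \<notin> I}"
  have "J \<in> ?A"
    using J ne ideal.one_imp_carrier by blast
  moreover have "\<Union>C \<in> ?A" if C: "C \<noteq> {}" "subset.chain ?A C" for C
  proof -
    have "subset.chain {I. ideal I R} C"
      using C(2) by (auto simp: subset.chain_def)
    then show ?thesis
      using chain_Union_is_ideal[of C] C by (auto simp: subset.chain_def)
  qed
  ultimately have "\<exists>M \<in> ?A. \<forall>X \<in> ?A. M \<subseteq> X \<longrightarrow> X = M"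
    by (intro subset_Zorn_nonempty) (rule ex_in_conv[THEN iffD1, OF exI])
  then obtain M where M: "M \<in> ?A" and max: "\<forall>X \<in> ?A. M \<subseteq> X \<longrightarrow> X = M" ..
  have "maximalideal M R"
  proof (rule maximalidealI)
    show "K = M \<or> K = carrier R" if "ideal K R" "M \<subseteq> K" for K
    proof (cases "\<one> \<in> K")
      case True
      then show ?thesis
        using ideal.one_imp_carrier[OF that(1)] by blast
    next
      case False
      then show ?thesis
        using that M bspec[OF max, of K] by auto
    qed
  qed (use M in auto)
  then show ?thesis
    using M by blast
qed

lemma (in cring) comaximal_principalE:
  assumes I: "ideal I R" and x: "x \<in> carrier R"
    and comax: "\<And>K. ideal K R \<Longrightarrow> I \<subseteq> K \<Longrightarrow> x \<in> K \<Longrightarrow> K = carrier R"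
  obtains i r where "i \<in> I" "r \<in> carrier R" "\<one> = i \<oplus> r \<otimes> x"
proof -
  have P: "ideal (PIdl x) R"
    using x by (rule cgenideal_ideal)
  have "I \<union> PIdl x \<subseteq> I <+>\<^bsub>R\<^esub> PIdl x"
    using genideal_self[of "I \<union> PIdl x"] ideal.Icarr[OF I] ideal.Icarr[OF P]
    unfolding union_genideal[OF I P] by blast
  then have "I <+>\<^bsub>R\<^esub> PIdl x = carrier R"
    using comax[OF add_ideals[OF I P]] cgenideal_self[OF x] by blast
  then have "\<one> \<in> I <+>\<^bsub>R\<^esub> PIdl x"
    by simp
  then show ?thesis
    using that by (auto simp: set_add_defs cgenideal_def)
qed

lemma (in cring) annihilator_ideal:
  assumes a: "a \<in> carrier R"
  shows "ideal {x \<in> carrier R. x \<otimes> a = \<zero>} R"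
proof (rule idealI[OF ring_axioms])
  show "subgroup {x \<in> carrier R. x \<otimes> a = \<zero>} (add_monoid R)"
    \<comment> \<open>Inverses in \<open>add_monoid R\<close> are folded back into
      \<open>\<ominus>\<close>, so that \<open>l_minus\<close> applies.\<close>
    using a by (intro add.subgroupI) (auto simp: l_distr l_minus simp flip: a_inv_def)
  show "y \<otimes> x \<in> {x \<in> carrier R. x \<otimes> a = \<zero>}" "x \<otimes> y \<in> {x \<in> carrier R. x \<otimes> a = \<zero>}"
    if "x \<in> {x \<in> carrier R. x \<otimes> a = \<zero>}" "y \<in> carrier R" for x y
    using that a m_lcomm[of x y a] by (auto simp: m_assoc)
qed

lemma (in cring) pure_comp_mult:
  assumes "a \<in> carrier R" "b \<in> carrier R"
  shows "a \<otimes> (\<one> \<ominus> b) = \<zero> \<longleftrightarrow> a = a \<otimes> b"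
  using assms r_right_minus_eq[of a "a \<otimes> b"] by (simp add: minus_eq r_distr r_minus)

section \<open>Purity and regularity\<close>

text \<open>If \<open>a = a \<otimes> b \<otimes> a\<close> with \<open>a\<close> in
  \<open>I\<close>, then \<open>b \<otimes> a\<close> lies in \<open>I\<close> and fixes
  \<open>a\<close> under multiplication.\<close>

lemma (in von_neumann_regular) ideal_pure:
  assumes "ideal I R"
  shows "pure_ideal I R"
proof -
  interpret ideal I R by fact
  show ?thesis
  proof
    fix a assume a: "a \<in> I"
    then obtain b where b: "b \<in> carrier R" "a = a \<otimes> b \<otimes> a"
      using regular Icarr by blast
    then have "a \<otimes> (\<one> \<ominus> b \<otimes> a) = \<zero>"
      using Icarr[OF a] by (subst pure_comp_mult) (simp_all add: m_assoc)
    then show "\<exists>b \<in> I. a \<otimes> (\<one> \<ominus> b) = \<zero>"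
      using I_l_closed[OF a b(1)] by blast
  qed
qed

text \<open>Purity of \<open>PIdl a\<close> at its own generator yields a multiple
  \<open>r \<otimes> a\<close> that fixes \<open>a\<close>.\<close>

lemma (in cring) von_neumann_regular_if_principal_pure:
  assumes pure: "\<And>I. principalideal I R \<Longrightarrow> pure_ideal I R"
  shows "von_neumann_regular R"
proof
  fix a assume a: "a \<in> carrier R"
  obtain b where "b \<in> PIdl a" "a \<otimes> (\<one> \<ominus> b) = \<zero>"
    using pure_ideal.pure[OF pure[OF cgenideal_is_principalideal[OF a]] cgenideal_self[OF a]] by blast
  then obtain r where r: "r \<in> carrier R" and "a \<otimes> (\<one> \<ominus> r \<otimes> a) = \<zero>"
    by (auto simp: cgenideal_def)
  then have "a = a \<otimes> r \<otimes> a"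
    using a by (simp add: pure_comp_mult m_assoc)
  then show "\<exists>b \<in> carrier R. a = a \<otimes> b \<otimes> a"
    using r by blast
qed

section \<open>Kernels of localization maps\<close>

lemma (in primeideal) kernel_loc_map_subset:
  "a_kernel R (localization_at R I) (loc_map R I) \<subseteq> I"
  unfolding kernel_loc_map
proof clarify
  fix a s assume "a \<in> carrier R" "s \<in> carrier R" "s \<notin> I" "s \<otimes> a = \<zero>"
  then show "a \<in> I"
    using I_prime[of s a] zero_closed by auto
qed

lemma (in primeideal) kernel_loc_map_eq_if_pure:
  assumes "pure_ideal I R"
  shows "a_kernel R (localization_at R I) (loc_map R I) = I"
proof
  show "I \<subseteq> a_kernel R (localization_at R I) (loc_map R I)"
    unfolding kernel_loc_map
  proof clarify
    fix a assume a: "a \<in> I"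
    then obtain b where b: "b \<in> I" "a \<otimes> (\<one> \<ominus> b) = \<zero>"
      using pure_ideal.pure[OF assms] by blast
    \<comment> \<open>The element \<open>\<one> \<ominus> b\<close> is the one that kills
      \<open>a\<close>. It avoids \<open>I\<close>, since adding \<open>b\<close> to it gives
      \<open>\<one>\<close>.\<close>
    have "\<one> \<ominus> b \<notin> I"
    proof
      assume "\<one> \<ominus> b \<in> I"
      then have "(\<one> \<ominus> b) \<oplus> b \<in> I"
        using additive_subgroup.a_closed[OF is_additive_subgroup _ b(1)] by blast
      moreover have "(\<one> \<ominus> b) \<oplus> b = \<one>"
        using Icarr[OF b(1)] by (simp add: minus_eq a_assoc l_neg)
      ultimately show False
        using I_notcarr one_imp_carrier by metis
    qed
    then show "a \<in> carrier R \<and> (\<exists>s \<in> carrier R - I. s \<otimes> a = \<zero>)"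
      using a b by (intro conjI bexI[of _ "\<one> \<ominus> b"]) (auto simp: Icarr m_comm)
  qed
qed (rule kernel_loc_map_subset)

lemma (in cring) von_neumann_regular_if_kernel_eq:
  assumes ker: "\<And>M. maximalideal M R \<Longrightarrow> a_kernel R (localization_at R M) (loc_map R M) = M"
  shows "von_neumann_regular R"
proof
  fix a assume a: "a \<in> carrier R"
  let ?N = "{x \<in> carrier R. x \<otimes> a = \<zero>}"
  have "K = carrier R" if K: "ideal K R" "?N \<subseteq> K" "a \<in> K" for K
  proof (rule ccontr)
    assume "K \<noteq> carrier R"
    then obtain M where M: "maximalideal M R" "K \<subseteq> M"
      using exists_maximalideal[OF K(1)] by blast
    \<comment> \<open>As \<open>a\<close> lies in \<open>M\<close>, some \<open>s\<close> outside
      \<open>M\<close> kills it; but then \<open>s\<close> is in \<open>?N\<close>, which lies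
      inside \<open>M\<close>.\<close>
    then have "a \<in> a_kernel R (localization_at R M) (loc_map R M)"
      using ker[OF M(1)] K(3) by blast
    then obtain s where "s \<in> carrier R - M" "s \<otimes> a = \<zero>"
      unfolding primeideal.kernel_loc_map[OF maximalideal_prime[OF M(1)]] by blast
    then show False
      using M(2) K(2) by blast
  qed
  then obtain s r where "s \<in> ?N" and sr: "r \<in> carrier R" "\<one> = s \<oplus> r \<otimes> a"
    by (rule comaximal_principalE[OF annihilator_ideal[OF a] a])
  then have s: "s \<in> carrier R" "s \<otimes> a = \<zero>"
    by simp_all
  have "a = \<one> \<otimes> a"
    using a by simp
  also have "\<dots> = (s \<oplus> r \<otimes> a) \<otimes> a"
    using sr(2) by simp
  also have "\<dots> = r \<otimes> a \<otimes> a"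
    using a s sr(1) by (simp add: l_distr)
  also have "r \<otimes> a = a \<otimes> r"
    using sr(1) a by (rule m_comm)
  finally show "\<exists>b \<in> carrier R. a = a \<otimes> b \<otimes> a"
    using sr(1) by blast
qed

section \<open>Localizations of a regular ring are fields\<close>

lemma (in field) semiprimitive: "semiprimitive_ring R"
proof
  have "\<zero> \<in> M" if "maximalideal M R" for M
    by (rule additive_subgroup.zero_closed[OF ideal.axioms(1)[OF maximalideal.axioms(1)[OF that]]])
  then show "jacobson_radical R = {\<zero>}"
    using zeromaximalideal by (auto simp: jacobson_radical_def)
qed

lemma (in primeideal) compl_one: "\<one> \<in> carrier R - I"
  using mult_submonoid_compl mult_submonoid.axioms(2) submonoid.one_closed by blast

lemma (in primeideal) compl_m_closed:
  "a \<in> carrier R - I \<Longrightarrow> b \<in> carrier R - I \<Longrightarrow> a \<otimes> b \<in> carrier R - I"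
  using I_prime by blast

text \<open>The inverse is the swapped fraction, legitimate because the numerator is also in
  \<open>S\<close>.\<close>

lemma (in mult_submonoid) loc_frac_Units:
  assumes "a \<in> S" "s \<in> S"
  shows "loc_frac R S a s \<in> Units (localization R S)"
proof -
  interpret L: cring "localization R S"
    by (rule cring_localization)
  have inv: "loc_frac R S x y \<otimes>\<^bsub>localization R S\<^esub> loc_frac R S y x = \<one>\<^bsub>localization R S\<^esub>"
    if "x \<in> S" "y \<in> S" for x y
    using that unfolding loc_one by (simp add: loc_mult_frac) (rule loc_frac_eqI, simp_all add: m_comm)
  show ?thesis
    unfolding Units_def using assms
    by (intro CollectI conjI bexI[of _ "loc_frac R S s a"]) (simp_all only: inv loc_frac_carrier S_carr)
qed

text \<open>Regularity makes \<open>I\<close> pure, so the kernel is all of \<open>I\<close>. A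
  fraction with numerator in \<open>I\<close> is therefore zero, and one with numerator outside
  \<open>I\<close> is a unit.\<close>

lemma (in primeideal) field_localization_at:
  assumes "von_neumann_regular R"
  shows "field (localization_at R I)"
proof -
  interpret S: mult_submonoid R "carrier R - I"
    by (rule mult_submonoid_compl)
  \<comment> \<open>as a rewrite rule this loops with \<open>Diff_iff\<close>\<close>
  note S.S_carr [simp del]
  interpret L: cring "localization_at R I"
    by (rule cring_localization_at)
  let ?L = "localization_at R I" and ?f = "loc_frac R (carrier R - I)"
  have ker: "a_kernel R ?L (loc_map R I) = I"
    using von_neumann_regular.ideal_pure[OF assms is_ideal] by (rule kernel_loc_map_eq_if_pure)
  show ?thesis
  proof (rule L.cring_fieldI, intro equalityI subsetI)
    have "\<zero>\<^bsub>?L\<^esub> \<noteq> \<one>\<^bsub>?L\<^esub>"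
    proof
      assume "\<zero>\<^bsub>?L\<^esub> = \<one>\<^bsub>?L\<^esub>"
      then have "\<one> \<in> a_kernel R ?L (loc_map R I)"
        using ring_hom_one[OF loc_map_hom] by (simp add: a_kernel_def')
      then show False
        using ker compl_one by blast
    qed
    then show "X \<in> carrier ?L - {\<zero>\<^bsub>?L\<^esub>}" if "X \<in> Units ?L" for X
      using that L.Units_closed L.Units_r_inv L.l_null L.Units_inv_closed by (metis Diff_iff singletonD)
  next
    fix X assume X: "X \<in> carrier ?L - {\<zero>\<^bsub>?L\<^esub>}"
    then obtain a s where as: "a \<in> carrier R" "s \<in> carrier R - I" "X = ?f a s"
      using S.loc_fracE[of X] by (auto simp: localization_at_def)
    have "a \<notin> I"
    proof
      assume "a \<in> I"
      then obtain u where u: "u \<in> carrier R - I" "u \<otimes> a = \<zero>"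
        using ker unfolding kernel_loc_map by blast
      have "X = \<zero>\<^bsub>?L\<^esub>"
        unfolding as(3) localization_at_def S.loc_zero
        using u as by (intro S.loc_frac_eqI'[of u] compl_one) auto
      then show False
        using X by blast
    qed
    then show "X \<in> Units ?L"
      using as S.loc_frac_Units by (simp add: localization_at_def)
  qed
qed

section \<open>The Jacobson radical of the local ring at a prime\<close>

text \<open>Invertibility of \<open>x\<close> in the residue field, phrased by elements so that no
  quotient ring is formed.\<close>

lemma (in cring) maximalideal_coset_inverse:
  assumes "maximalideal N R" "x \<in> carrier R" "x \<notin> N"
  shows "\<exists>y \<in> carrier R. \<one> \<ominus> y \<otimes> x \<in> N"
proof -
  interpret maximalideal N R by fact
  have "K = carrier R" if "ideal K R" "N \<subseteq> K" "x \<in> K" for K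
    using that I_maximal[OF that(1,2)] ideal.Icarr[OF that(1)] assms(3) by blast
  then obtain n y where ny: "n \<in> N" "y \<in> carrier R" "\<one> = n \<oplus> y \<otimes> x"
    by (rule comaximal_principalE[OF is_ideal assms(2)])
  have "\<one> \<ominus> y \<otimes> x = n"
    using ny(2) assms(2) Icarr[OF ny(1)] unfolding ny(3)
    by (simp add: minus_eq a_assoc r_neg)
  then show ?thesis
    using ny by blast
qed

text \<open>If a maximal ideal \<open>N\<close> missed the fraction a/1, it would contain 1 -
  (c/t)(a/1) = (t - ca)/t for some c/t. The numerator is outside \<open>I\<close>, so
  \<open>N\<close> would contain a unit.\<close>

lemma (in primeideal) loc_map_in_jacobson_radical:
  assumes a: "a \<in> I"
  shows "loc_map R I a \<in> jacobson_radical (localization_at R I)"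
proof -
  interpret S: mult_submonoid R "carrier R - I"
    by (rule mult_submonoid_compl)
  note S.S_carr [simp del]
  interpret L: cring "localization_at R I"
    by (rule cring_localization_at)
  let ?L = "localization_at R I" and ?f = "loc_frac R (carrier R - I)"
  have ac: "a \<in> carrier R"
    using a by (rule Icarr)
  have xc: "loc_map R I a \<in> carrier ?L"
    using loc_map_hom ac by (rule ring_hom_closed)
  have "loc_map R I a \<in> N" if N: "maximalideal N ?L" for N
  proof (rule ccontr)
    interpret N: maximalideal N ?L by fact
    assume "loc_map R I a \<notin> N"
    then obtain Y where Y: "Y \<in> carrier ?L" "\<one>\<^bsub>?L\<^esub> \<ominus>\<^bsub>?L\<^esub> Y \<otimes>\<^bsub>?L\<^esub> loc_map R I a \<in> N"
      using L.maximalideal_coset_inverse[OF N xc] by blast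
    then obtain c t where ct: "c \<in> carrier R" "t \<in> carrier R - I" "Y = ?f c t"
      using S.loc_fracE[of Y] by (auto simp: localization_at_def)
    have ca: "c \<otimes> a \<in> I"
      using I_l_closed[OF a ct(1)] .
    \<comment> \<open>Otherwise adding \<open>c \<otimes> a\<close>, which is in \<open>I\<close>,
      would put \<open>t\<close> in \<open>I\<close>.\<close>
    have tca: "t \<ominus> c \<otimes> a \<in> carrier R - I"
    proof -
      have "(t \<ominus> c \<otimes> a) \<oplus> c \<otimes> a = t"
        using ct ac by (simp add: minus_eq a_assoc l_neg)
      then show ?thesis
        using additive_subgroup.a_closed[OF is_additive_subgroup _ ca, of "t \<ominus> c \<otimes> a"] ct ac
        by auto
    qed
    have u: "?f (t \<ominus> c \<otimes> a) t \<in> Units ?L"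
      unfolding localization_at_def using tca ct(2) by (rule S.loc_frac_Units)
    have Yx: "Y \<otimes>\<^bsub>?L\<^esub> loc_map R I a = ?f (c \<otimes> a) t"
      unfolding ct(3) loc_map_def localization_at_def
      using ct ac by (subst S.loc_mult_frac) (use compl_one in auto)
    \<comment> \<open>The difference is found by checking a sum and cancelling, which avoids a
      formula for the negative of a fraction.\<close>
    have "?f (t \<ominus> c \<otimes> a) t \<oplus>\<^bsub>?L\<^esub> ?f (c \<otimes> a) t = ?f (t \<otimes> (t \<ominus> c \<otimes> a) \<oplus> t \<otimes> (c \<otimes> a)) (t \<otimes> t)"
      unfolding localization_at_def using tca ct ac by (intro S.loc_add_frac) auto
    also have "t \<otimes> (t \<ominus> c \<otimes> a) \<oplus> t \<otimes> (c \<otimes> a) = t \<otimes> t"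
      using ct ac by (simp add: minus_eq a_assoc l_neg flip: r_distr)
    also have "?f (t \<otimes> t) (t \<otimes> t) = \<one>\<^bsub>?L\<^esub>"
      unfolding localization_at_def S.loc_one
      using ct compl_m_closed[OF ct(2) ct(2)] compl_one by (intro S.loc_frac_eqI) (auto simp: m_comm)
    finally have sum: "?f (t \<ominus> c \<otimes> a) t \<oplus>\<^bsub>?L\<^esub> ?f (c \<otimes> a) t = \<one>\<^bsub>?L\<^esub>" .
    have "?f (c \<otimes> a) t \<in> carrier ?L"
      using L.m_closed[OF Y(1) xc] unfolding Yx .
    then have "\<one>\<^bsub>?L\<^esub> \<ominus>\<^bsub>?L\<^esub> Y \<otimes>\<^bsub>?L\<^esub> loc_map R I a = ?f (t \<ominus> c \<otimes> a) t"
      unfolding Yx sum[symmetric] using L.Units_closed[OF u]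
      by (simp only: L.minus_eq L.a_assoc L.r_neg L.r_zero L.a_inv_closed)
    then have "?f (t \<ominus> c \<otimes> a) t \<in> N"
      using Y(2) by simp
    then have "\<one>\<^bsub>?L\<^esub> \<in> N"
      using N.I_l_closed L.Units_l_inv[OF u] L.Units_inv_closed[OF u] by metis
    then show False
      using N.I_notcarr N.one_imp_carrier by simp
  qed
  then show ?thesis
    unfolding jacobson_radical_def using xc by blast
qed

text \<open>Elements of \<open>I\<close> map into the Jacobson radical, which is zero here.\<close>

lemma (in primeideal) kernel_loc_map_eq_if_semiprimitive:
  assumes "semiprimitive_ring (localization_at R I)"
  shows "a_kernel R (localization_at R I) (loc_map R I) = I"
proof
  show "I \<subseteq> a_kernel R (localization_at R I) (loc_map R I)"
    using loc_map_in_jacobson_radical semiprimitive_ring.jacobson_radical_zero[OF assms] Icarr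
    by (auto simp: a_kernel_def')
qed (rule kernel_loc_map_subset)

theorem corollary3p5:
  fixes R :: "('a, 'b) ring_scheme" (structure)
  assumes "cring R"
  shows
    "(von_neumann_regular R \<longleftrightarrow> (\<forall>I. ideal I R \<longrightarrow> pure_ideal I R)) \<and>
     (von_neumann_regular R \<longleftrightarrow> (\<forall>I. principalideal I R \<longrightarrow> pure_ideal I R)) \<and>
     (von_neumann_regular R \<longleftrightarrow> (\<forall>M. maximalideal M R \<longrightarrow> pure_ideal M R)) \<and>
     (von_neumann_regular R \<longleftrightarrow>
        (\<forall>M. maximalideal M R \<longrightarrow> a_kernel R (localization_at R M) (loc_map R M) = M)) \<and>
     (von_neumann_regular R \<longleftrightarrow>
        (\<forall>P. primeideal P R \<longrightarrow> semiprimitive_ring (localization_at R P))) \<and>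
     (von_neumann_regular R \<longleftrightarrow>
        (\<forall>M. maximalideal M R \<longrightarrow> semiprimitive_ring (localization_at R M)))"
    (is "(?i \<longleftrightarrow> ?ii) \<and> (?i \<longleftrightarrow> ?iii) \<and> (?i \<longleftrightarrow> ?iv) \<and> (?i \<longleftrightarrow> ?v) \<and> (?i \<longleftrightarrow> ?vi) \<and> (?i \<longleftrightarrow> ?vii)")
proof -
  interpret cring R by fact
  \<comment> \<open>Three cycles through (i) cover everything: (i), (ii), (iii); then (i), (ii),
    (iv), (v); then (i), (vi), (vii), (v).\<close>
  have i_ii: "?i \<Longrightarrow> ?ii"
    using von_neumann_regular.ideal_pure by blast
  have ii_iii: "?ii \<Longrightarrow> ?iii" and ii_iv: "?ii \<Longrightarrow> ?iv"
    using principalideal.axioms(1) maximalideal.axioms(1) by blast+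
  have iii_i: "?iii \<Longrightarrow> ?i"
    using von_neumann_regular_if_principal_pure by blast
  have iv_v: "?iv \<Longrightarrow> ?v"
    using maximalideal_prime primeideal.kernel_loc_map_eq_if_pure by blast
  have v_i: "?v \<Longrightarrow> ?i"
    using von_neumann_regular_if_kernel_eq by blast
  have i_vi: "?i \<Longrightarrow> ?vi"
    using primeideal.field_localization_at field.semiprimitive by blast
  have vi_vii: "?vi \<Longrightarrow> ?vii"
    using maximalideal_prime by blast
  have vii_v: "?vii \<Longrightarrow> ?v"
    using maximalideal_prime primeideal.kernel_loc_map_eq_if_semiprimitive by blast
  show ?thesis
  proof (intro conjI)
    show "?i \<longleftrightarrow> ?ii"
      by (rule iffI[OF i_ii iii_i[OF ii_iii]])
    show "?i \<longleftrightarrow> ?iii"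
      by (rule iffI[OF ii_iii[OF i_ii] iii_i])
    show "?i \<longleftrightarrow> ?iv"
      by (rule iffI[OF ii_iv[OF i_ii] v_i[OF iv_v]])
    show "?i \<longleftrightarrow> ?v"
      by (rule iffI[OF iv_v[OF ii_iv[OF i_ii]] v_i])
    show "?i \<longleftrightarrow> ?vi"
      by (rule iffI[OF i_vi v_i[OF vii_v[OF vi_vii]]])
    show "?i \<longleftrightarrow> ?vii"
      by (rule iffI[OF vi_vii[OF i_vi] v_i[OF vii_v]])
  qed
qed

end
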